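(* Let $\delta_3>0$. Consider a sequence of linear ternary codes $C_n\subseteq\mathbb{F}_3^n$ ($n\to\infty$) of dimension $m_n$ with $m_n/n\to R$ and $3$-hash distance $d_3(C_n)$ with $d_3(C_n)/n\to\delta_3$. Then $R\leq \frac12\delta^*-\delta_3$, where $\delta^*$ is the unique solution of the equation $$\tfrac12\delta-\delta_3=R_{LP1}(3,\delta).$$
   Context: For a code $C\subseteq\mathbb{F}_q^n$ and $k\le q$, the joint $k$-hash distance of $k$ codewords is the number of coordinates in which they are all pairwise distinct; the $k$-hash distance $d_k(C)$ is the minimum of this over all $k$-tuples of distinct codewords. For a prime power $q$ and $0\le\delta\le (q-1)/q$, $$R_{LP1}(q,\delta)=H_q\!\left(\frac{(q-1)-(q-2)\delta-2\sqrt{(q-1)\delta(1-\delta)}}{q}\right),\qquad H_q(t)=t\log_q(q-1)-t\log_q t-(1-t)\log_q(1-t).$$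
   Formalization: δ* is taken to be any solution in [0,2/3]; its existence is assumed and its uniqueness not asserted. For δ_3>1/3 there is no solution (repetition codes have δ_3=1, R=0), so δ* is undefined there; for δ_3≤1/3 it exists and is unique by monotonicity. *)

theory Defs
  imports "HOL-Analysis.Analysis" "HOL-Library.Numeral_Type"
begin

text \<open>The field F_3 is the type 3 from HOL-Library.Numeral_Type (arithmetic mod 3).
  Words of length n over F_3 are lists of length n.\<close>

definition linear_code :: "nat \<Rightarrow> (3 list) set \<Rightarrow> bool" where
  "linear_code n C \<longleftrightarrow> C \<subseteq> {v. length v = n} \<and> replicate n 0 \<in> C \<and>
     (\<forall>u\<in>C. \<forall>v\<in>C. map2 (+) u v \<in> C) \<and> (\<forall>a::3. \<forall>v\<in>C. map ((*) a) v \<in> C)"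

definition lin_comb :: "nat \<Rightarrow> nat \<Rightarrow> (nat \<Rightarrow> 3 list) \<Rightarrow> (nat \<Rightarrow> 3) \<Rightarrow> 3 list" where
  "lin_comb n m b a = map (\<lambda>j. \<Sum>i<m. a i * (b i ! j)) [0..<n]"

definition code_dim :: "nat \<Rightarrow> (3 list) set \<Rightarrow> nat \<Rightarrow> bool" where
  "code_dim n C m \<longleftrightarrow> (\<exists>b. (\<forall>i<m. b i \<in> C) \<and>
      bij_betw (lin_comb n m b) ({..<m} \<rightarrow>\<^sub>E UNIV) C)"

definition joint_hash :: "nat \<Rightarrow> 'a list list \<Rightarrow> nat" where
  "joint_hash n cs = card {i. i < n \<and> distinct (map (\<lambda>c. c ! i) cs)}"

text \<open>k-hash distance: minimum over k-tuples of distinct codewords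
  (Inf of the empty set of naturals is 0).\<close>
definition hash_dist :: "nat \<Rightarrow> nat \<Rightarrow> 'a list set \<Rightarrow> nat" where
  "hash_dist k n C = Inf {joint_hash n cs | cs. length cs = k \<and> distinct cs \<and> set cs \<subseteq> C}"

definition Hq :: "real \<Rightarrow> real \<Rightarrow> real" where
  "Hq q t = t * log q (q - 1) - t * log q t - (1 - t) * log q (1 - t)"

definition R_LP1 :: "real \<Rightarrow> real \<Rightarrow> real" where
  "R_LP1 q \<delta> = Hq q (((q - 1) - (q - 2) * \<delta> - 2 * sqrt ((q - 1) * \<delta> * (1 - \<delta>))) / q)"

end

(*
  A nonzero codeword t and a codeword e outside {0, t} form with 0 a triple whose joint hash
  distance counts the zeros of t + e on the support of t. Hence these sums form a multiple
  blocking system, and the polynomial method of Jamison and Bruen bounds the minimum distance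
  from below by 2 (d_3 + m) - 4, asymptotically R <= delta / 2 - delta_3.

  The first linear programming bound for a linear code C follows by comparing the two sides of
  the Parseval identity over C for a nonnegative function f supported in a Hamming ball whose sum
  over the neighbours of any word is at least lambda f: if lambda exceeds by 1 the
  adjacency eigenvalues 2n - 3 wt(c) of all nonzero codewords c, then |C| is at most (2n + 1) times the
  size of the ball.

  Let rho_0 be the argument of H_3 in R_LP1(3, delta_star). If R were larger than
  delta_star / 2 - delta_3, the relative distance would eventually exceed delta_star, so balls of
  radius rho n give R <= H_3(rho) for all rho in (rho_0, 2/3); letting rho decrease to rho_0 yields
  R <= R_LP1(3, delta_star) = delta_star / 2 - delta_3, a contradiction.
*)
theory Submission
  imports Defs "HOL-Computational_Algebra.Polynomial"
begin

subsection \<open>Multiple blocking sets over the field of three elements\<close>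

lemma F3_cases: "(x::3) = 0 \<or> x = 1 \<or> x = 2"
  using exhaust_3[of x] by auto

lemma UNIV_F3: "(UNIV :: 3 set) = {0, 1, 2}"
  using F3_cases by blast

lemma F3_mult_eq_0_iff: "(x::3) * y = 0 \<longleftrightarrow> x = 0 \<or> y = 0"
  using F3_cases[of x] F3_cases[of y] by auto

lemma F3_prod_eq_0_iff: "finite A \<Longrightarrow> prod f A = (0::3) \<longleftrightarrow> (\<exists>a\<in>A. f a = 0)"
  by (induction A rule: finite_induct) (auto simp: F3_mult_eq_0_iff)

text \<open>Exponent 0 gives 3 = 0 by the characteristic, exponent 1 gives 0 + 1 + 2 = 0. Hence only
  monomials in which a variable has degree at least 2 survive summation over that variable.\<close>

lemma F3_sum_power: "k < 2 \<Longrightarrow> (\<Sum>a\<in>(UNIV :: 3 set). a ^ k) = 0"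
  unfolding UNIV_F3 less_2_cases_iff by (elim disjE) simp_all

lemma sum_PiE_insert:
  assumes "i \<notin> N"
  shows "sum f (Pi\<^sub>E (insert i N) B) = (\<Sum>a\<in>B i. \<Sum>x\<in>Pi\<^sub>E N B. f (x(i := a)))"
proof -
  have "sum f (Pi\<^sub>E (insert i N) B) = (\<Sum>(a, x)\<in>B i \<times> Pi\<^sub>E N B. f (x(i := a)))"
    unfolding PiE_insert_eq
    by (subst sum.reindex[OF inj_combinator[OF assms]]) (simp add: case_prod_beta o_def)
  then show ?thesis by (simp add: sum.cartesian_product)
qed

text \<open>Each variable summed over the field has to be picked from at least two of the factors,
  or its power sum vanishes. So at most \<open>card J - 2 * card N\<close> factors are left to
  contribute powers of X.\<close>

lemma coeff_sum_prod_eq_0: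
  fixes v :: "'i \<Rightarrow> 'j \<Rightarrow> 3" and L :: "'j \<Rightarrow> 3 poly"
  assumes "finite N" "finite J" "\<And>j. j \<in> J \<Longrightarrow> degree (L j) \<le> 1"
    and "card J < 2 * card N + k"
  shows "coeff (\<Sum>x\<in>N \<rightarrow>\<^sub>E UNIV. \<Prod>j\<in>J. L j + [:\<Sum>i\<in>N. x i * v i j:]) k = 0"
  using assms
proof (induction N arbitrary: J rule: finite_induct)
  case empty
  have "degree (prod L J) \<le> (\<Sum>j\<in>J. (degree \<circ> L) j)"
    using empty by (intro degree_prod_sum_le) auto
  also have "\<dots> \<le> (\<Sum>j\<in>J. 1)"
    using empty by (intro sum_mono) auto
  finally show ?case
    using empty by (simp add: coeff_eq_0)
next
  case (insert i N)
  define M where "M x j = L j + [:\<Sum>i\<in>N. x i * v i j:]" for x j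
  \<comment> \<open>Here \<open>T\<close> is the set of factors from which the new variable is
    picked. A small \<open>T\<close> dies by its power sum, a larger one leaves few enough factors
    for the induction hypothesis; this is why \<open>J\<close> is kept arbitrary.\<close>
  have term_zero: "coeff ([:(\<Sum>a\<in>(UNIV::3 set). a ^ card T) * prod (v i) T:] * (\<Sum>x\<in>N \<rightarrow>\<^sub>E UNIV. prod (M x) (J - T))) k = 0"
    if T: "T \<in> Pow J" for T
  proof (cases "card T < 2")
    case True
    then show ?thesis by (simp add: F3_sum_power)
  next
    case False
    have "card (J - T) = card J - card T"
      using T insert.prems(1) by (auto intro: card_Diff_subset finite_subset)
    moreover have "card T \<le> card J"
      using T insert.prems(1) by (auto intro: card_mono)
    ultimately have "card (J - T) < 2 * card N + k"
      using False insert.prems insert.hyps by auto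
    then have "coeff (\<Sum>x\<in>N \<rightarrow>\<^sub>E UNIV. prod (M x) (J - T)) k = 0"
      unfolding M_def using insert.prems by (intro insert.IH) auto
    then show ?thesis by simp
  qed
  have "(\<Sum>x\<in>insert i N \<rightarrow>\<^sub>E UNIV. \<Prod>j\<in>J. L j + [:\<Sum>i\<in>insert i N. x i * v i j:])
      = (\<Sum>a\<in>UNIV. \<Sum>x\<in>N \<rightarrow>\<^sub>E UNIV. \<Prod>j\<in>J. [:a * v i j:] + M x j)"
  proof (subst sum_PiE_insert[OF insert.hyps(2)], intro sum.cong refl prod.cong)
    fix a :: 3 and x j
    have "(\<Sum>i'\<in>N. (x(i := a)) i' * v i' j) = (\<Sum>i'\<in>N. x i' * v i' j)"
      using insert.hyps by (intro sum.cong) auto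
    then show "L j + [:\<Sum>i'\<in>insert i N. (x(i := a)) i' * v i' j:] = [:a * v i j:] + M x j"
      using insert.hyps by (simp add: M_def algebra_simps)
  qed
  also have "\<dots> = (\<Sum>a\<in>UNIV. \<Sum>x\<in>N \<rightarrow>\<^sub>E UNIV. \<Sum>T\<in>Pow J.
      [:a ^ card T * prod (v i) T:] * prod (M x) (J - T))"
  proof (intro sum.cong refl)
    fix a :: 3 and x
    have pc: "(\<Prod>j\<in>T. [:c j:]) = [:prod c T:]" for c :: "'j \<Rightarrow> 3" and T
      by (induction T rule: infinite_finite_induct) (auto simp: one_pCons)
    show "(\<Prod>j\<in>J. [:a * v i j:] + M x j) = (\<Sum>T\<in>Pow J. [:a ^ card T * prod (v i) T:] * prod (M x) (J - T))"
      using insert.prems(1) by (simp add: prod_add pc prod.distrib)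
  qed
  also have "\<dots> = (\<Sum>a\<in>UNIV. \<Sum>T\<in>Pow J. \<Sum>x\<in>N \<rightarrow>\<^sub>E UNIV.
      [:a ^ card T * prod (v i) T:] * prod (M x) (J - T))"
    by (intro sum.cong refl sum.swap)
  also have "\<dots> = (\<Sum>T\<in>Pow J. \<Sum>a\<in>UNIV. \<Sum>x\<in>N \<rightarrow>\<^sub>E UNIV.
      [:a ^ card T * prod (v i) T:] * prod (M x) (J - T))"
    by (rule sum.swap)
  also have "\<dots> = (\<Sum>T\<in>Pow J. [:(\<Sum>a\<in>UNIV. a ^ card T) * prod (v i) T:] * (\<Sum>x\<in>N \<rightarrow>\<^sub>E UNIV. prod (M x) (J - T)))"
  proof (intro sum.cong refl)
    fix T
    have ps: "(\<Sum>a\<in>S. [:c a:]) = [:sum c S:]" for c :: "3 \<Rightarrow> 3" and S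
      by (induction S rule: infinite_finite_induct) auto
    show "(\<Sum>a\<in>UNIV. \<Sum>x\<in>N \<rightarrow>\<^sub>E UNIV. [:a ^ card T * prod (v i) T:] * prod (M x) (J - T))
       = [:(\<Sum>a\<in>UNIV. a ^ card T) * prod (v i) T:] * (\<Sum>x\<in>N \<rightarrow>\<^sub>E UNIV. prod (M x) (J - T))"
      unfolding sum_distrib_left[symmetric] sum_distrib_right[symmetric] ps by (simp add: sum_distrib_right)
  qed
  finally show ?case
    using term_zero by (simp add: coeff_sum)
qed

lemma linear_power_dvd_prod:
  fixes t u :: "'j \<Rightarrow> 3"
  assumes "finite A" "s \<le> card A" "\<And>j. j \<in> A \<Longrightarrow> t j + c * u j = 0"
  shows "[:-c, 1:] ^ s dvd (\<Prod>j\<in>A. [:t j, u j:])"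
proof -
  have "[:-c, 1:] ^ s dvd [:-c, 1:] ^ card A"
    using assms(2) by (rule le_imp_power_dvd)
  also have "\<dots> = (\<Prod>j\<in>A. [:-c, 1:])" by simp
  also have "\<dots> dvd (\<Prod>j\<in>A. [:t j, u j:])"
  proof (rule prod_dvd_prod)
    fix j assume "j \<in> A"
    then have "t j = - (c * u j)"
      using assms(3) by (simp add: eq_neg_iff_add_eq_0)
    then have "[:t j, u j:] = [:-c, 1:] * [:u j:]" by simp
    then show "[:-c, 1:] dvd [:t j, u j:]" by (metis dvd_triv_left)
  qed
  finally show ?thesis .
qed

text \<open>A factor with both roots 1 and 2 is the zero polynomial and settles the claim at once.
  Otherwise the two roots come from disjoint sets of factors, so the two powers divide the product
  together.\<close>

lemma multiple_zeros_dvd_prod: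
  fixes t u :: "'j \<Rightarrow> 3"
  assumes J: "finite J"
    and 1: "s \<le> card {j\<in>J. t j + 1 * u j = 0}" and 2: "s \<le> card {j\<in>J. t j + 2 * u j = 0}"
  shows "[:-1, 1:] ^ s * [:-2, 1:] ^ s dvd (\<Prod>j\<in>J. [:t j, u j:])"
proof (cases "\<exists>j\<in>J. t j = 0 \<and> u j = 0")
  case True
  then have "(\<Prod>j\<in>J. [:t j, u j:]) = 0"
    using J by (intro prod_zero) auto
  then show ?thesis by simp
next
  case False
  define A B where "A = {j\<in>J. t j + 1 * u j = 0}" and "B = {j\<in>J. t j + 2 * u j = 0}"
  have fin: "finite A" "finite B" using J by (auto simp: A_def B_def)
  have "A \<inter> B = {}"
  proof (rule ccontr)
    assume "A \<inter> B \<noteq> {}"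
    then obtain j where j: "j \<in> J" "t j + u j = 0" "t j + 2 * u j = 0"
      by (auto simp: A_def B_def)
    have "u j = (t j + 2 * u j) - (t j + u j)" by simp
    then have "u j = 0" using j by simp
    then show False using False j by auto
  qed
  have "[:-1, 1:] ^ s * [:-2, 1:] ^ s dvd (\<Prod>j\<in>A. [:t j, u j:]) * (\<Prod>j\<in>B. [:t j, u j:])"
    using 1 2 fin by (intro mult_dvd_mono linear_power_dvd_prod) (auto simp: A_def B_def)
  also have "\<dots> = (\<Prod>j\<in>A \<union> B. [:t j, u j:])"
    using fin \<open>A \<inter> B = {}\<close> by (simp add: prod.union_disjoint)
  also have "\<dots> dvd (\<Prod>j\<in>J. [:t j, u j:])"
    using J by (intro prod_dvd_prod_subset) (auto simp: A_def B_def)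
  finally show ?thesis .
qed

text \<open>Monicity is stated through a coefficient because degrees of products need not add over a
  general commutative ring.\<close>

lemma coeff_linear_power: "coeff ([:c, 1:] ^ n :: 'a :: comm_ring_1 poly) n = 1"
proof (induction n)
  case (Suc n)
  have "degree ([:c, 1:] * [:c, 1:] ^ n :: 'a poly) = degree [:c, 1::'a:] + degree ([:c, 1::'a:] ^ n)"
    using degree_linear_power[of c "Suc n"] by (simp add: degree_linear_power)
  then show ?case
    using Suc coeff_mult_degree_sum[of "[:c, 1::'a:]" "[:c, 1:] ^ n"] by (simp add: degree_linear_power)
qed simp

text \<open>Summing the product of the forms over the variables in \<open>N\<close> leaves a polynomial \<open>P\<close> in one
  variable, of degree at most \<open>card J - 2 * card N\<close>. It is divisible by \<open>((X - 1) * (X - 2)) ^ s\<close>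
  and does not vanish at 0.\<close>

lemma multiple_blocking_bound:
  fixes t u :: "'j \<Rightarrow> 3" and v :: "'i \<Rightarrow> 'j \<Rightarrow> 3"
  assumes N: "finite N" and J: "finite J" and t: "\<And>j. j \<in> J \<Longrightarrow> t j \<noteq> 0" and s: "0 < s"
    and zeros: "\<And>x a. x \<in> N \<rightarrow>\<^sub>E UNIV \<Longrightarrow> a \<noteq> 0 \<or> (\<exists>i\<in>N. x i \<noteq> 0) \<Longrightarrow>
      s \<le> card {j\<in>J. t j + a * u j + (\<Sum>i\<in>N. x i * v i j) = 0}"
  shows "2 * s + 2 * card N \<le> card J"
proof (rule ccontr)
  assume less: "\<not> ?thesis"
  define F where "F x = (\<Prod>j\<in>J. [:t j, u j:] + [:\<Sum>i\<in>N. x i * v i j:])" for x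
  define P where "P = (\<Sum>x\<in>N \<rightarrow>\<^sub>E UNIV. F x)"
  define M :: "3 poly" where "M = [:-1, 1:] ^ s * [:-2, 1:] ^ s"
  have "M dvd P"
    unfolding P_def
  proof (rule dvd_sum)
    fix x :: "'i \<Rightarrow> 3" assume x: "x \<in> N \<rightarrow>\<^sub>E UNIV"
    have F: "F x = (\<Prod>j\<in>J. [:t j + (\<Sum>i\<in>N. x i * v i j), u j:])"
      by (simp add: F_def)
    have "s \<le> card {j\<in>J. (t j + (\<Sum>i\<in>N. x i * v i j)) + a * u j = 0}" if "a \<noteq> 0" for a
      using zeros[OF x, of a] that by (simp add: add_ac)
    from this[of 1] this[of 2] have "M dvd (\<Prod>j\<in>J. [:t j + (\<Sum>i\<in>N. x i * v i j), u j:])"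
      unfolding M_def by (intro multiple_zeros_dvd_prod J) simp_all
    then show "M dvd F x"
      unfolding F .
  qed
  then obtain Q where Q: "P = Q * M" by (metis dvd_def mult.commute)
  have "coeff M (s + s) = 1"
    using coeff_mult_degree_sum[of "[:-1, 1::3:] ^ s" "[:-2, 1::3:] ^ s"]
    unfolding M_def coeff_linear_power degree_linear_power by simp
  then have M: "coeff M (2 * s) = 1"
    by (simp only: mult_2)
  have degM: "degree M = 2 * s"
  proof (rule antisym)
    have "degree M \<le> degree ([:-1, 1::3:] ^ s) + degree ([:-2, 1::3:] ^ s)"
      unfolding M_def by (rule degree_mult_le)
    then show "degree M \<le> 2 * s" by (simp add: degree_linear_power)
    show "2 * s \<le> degree M" using M by (intro le_degree) auto
  qed
  \<comment> \<open>Since \<open>M\<close> is monic of degree \<open>2 * s\<close>, the leading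
    coefficient of \<open>Q\<close> reappears in \<open>P\<close> at a position where, by
    \<open>less\<close>, the coefficient vanishes. This forces \<open>Q = 0\<close>.\<close>
  have "lead_coeff Q = coeff P (degree Q + 2 * s)"
    using coeff_mult_degree_sum[of Q M] M by (simp add: Q degM)
  also have "\<dots> = 0"
    unfolding P_def F_def using N J less by (intro coeff_sum_prod_eq_0) auto
  finally have "P = 0" using Q by simp
  have eval: "poly (F x) 0 = (\<Prod>j\<in>J. t j + (\<Sum>i\<in>N. x i * v i j))" for x
    by (simp add: F_def poly_prod)
  let ?z = "\<lambda>i\<in>N. 0 :: 3"
  \<comment> \<open>Evaluation at 0 is the case \<open>a = 0\<close> of \<open>zeros\<close>: every
    nonzero \<open>x\<close> has a vanishing factor, and only the product of the \<open>t j\<close>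
    remains.\<close>
  have "poly (F x) 0 = 0" if x: "x \<in> (N \<rightarrow>\<^sub>E UNIV) - {?z}" for x
  proof -
    have "\<exists>i\<in>N. x i \<noteq> 0"
    proof (rule ccontr)
      assume *: "\<not> (\<exists>i\<in>N. x i \<noteq> 0)"
      have "x = ?z"
        using x by (intro PiE_ext[of x N "\<lambda>_. UNIV" ?z]) (use * in auto)
      then show False using x by simp
    qed
    then have "0 < card {j\<in>J. t j + 0 * u j + (\<Sum>i\<in>N. x i * v i j) = 0}"
      using x s by (intro less_le_trans[OF s zeros]) auto
    then have "\<exists>j\<in>J. t j + (\<Sum>i\<in>N. x i * v i j) = 0"
      by (auto simp: card_gt_0_iff)
    then show ?thesis
      unfolding eval F3_prod_eq_0_iff[OF J] .
  qed
  then have "poly P 0 = (\<Sum>x\<in>{?z}. poly (F x) 0)"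
    unfolding P_def poly_sum using N
    by (intro sum.mono_neutral_right) (auto intro!: finite_PiE)
  also have "\<dots> = prod t J"
    by (simp add: eval)
  finally show False
    using \<open>P = 0\<close> t J by (auto simp: F3_prod_eq_0_iff)
qed

subsection \<open>Minimum distance and 3-hash distance\<close>

lemma lin_comb_nth: "j < n \<Longrightarrow> lin_comb n m b a ! j = (\<Sum>i<m. a i * (b i ! j))"
  by (simp add: lin_comb_def)

lemma lin_comb_zero: "(\<And>i. i < m \<Longrightarrow> a i = 0) \<Longrightarrow> lin_comb n m b a = replicate n 0"
  by (auto simp: lin_comb_def intro!: nth_equalityI)

lemma hash_dist_le: "length cs = k \<Longrightarrow> distinct cs \<Longrightarrow> set cs \<subseteq> C \<Longrightarrow> hash_dist k n C \<le> joint_hash n cs"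
  unfolding hash_dist_def by (intro cInf_lower) auto

text \<open>The forms are indexed by the support of \<open>t\<close>. A basis index
  \<open>i0\<close> occurring in \<open>t\<close> is discarded, one more index \<open>i1\<close>
  supplies the polynomial variable, and the other \<open>m - 2\<close> indices are summed
  over.\<close>

lemma weight_ge_hash_dist:
  assumes C: "linear_code n C" and dim: "code_dim n C m" and m: "2 \<le> m"
    and pos: "0 < hash_dist 3 n C" and t: "t \<in> C" "t \<noteq> replicate n 0"
  shows "2 * hash_dist 3 n C + 2 * (m - 2) \<le> card {j. j < n \<and> t ! j \<noteq> 0}"
proof -
  obtain b where bij: "bij_betw (lin_comb n m b) ({..<m} \<rightarrow>\<^sub>E UNIV) C"
    using dim by (auto simp: code_dim_def)
  have inj: "inj_on (lin_comb n m b) ({..<m} \<rightarrow>\<^sub>E UNIV)"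
    and img: "\<And>y. y \<in> {..<m} \<rightarrow>\<^sub>E UNIV \<Longrightarrow> lin_comb n m b y \<in> C"
    using bij by (auto simp: bij_betw_def)
  obtain a0 where a0: "a0 \<in> {..<m} \<rightarrow>\<^sub>E UNIV" "t = lin_comb n m b a0"
    using bij t(1) by (auto simp: bij_betw_def)
  then obtain i0 where i0: "i0 < m" "a0 i0 \<noteq> 0"
    using t(2) lin_comb_zero[of m a0 n b] by blast
  \<comment> \<open>Any index other than \<open>i0\<close> would do; \<open>2 \<le> m\<close>
    provides one.\<close>
  define i1 where "i1 = (if i0 = 0 then 1 else 0 :: nat)"
  have i1: "i1 < m" "i1 \<noteq> i0" using m by (auto simp: i1_def)
  define N where "N = {..<m} - {i0, i1}"
  have cardN: "card N = m - 2"
    using i0 i1 by (simp add: N_def card_Diff_subset)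
  define J where "J = {j. j < n \<and> t ! j \<noteq> 0}"
  have "2 * hash_dist 3 n C + 2 * card N \<le> card J"
  proof (rule multiple_blocking_bound[where t = "\<lambda>j. t ! j" and u = "\<lambda>j. b i1 ! j" and v = "\<lambda>i j. b i ! j"])
    show "finite N" "finite J" by (auto simp: N_def J_def)
    show "t ! j \<noteq> 0" if "j \<in> J" for j using that by (simp add: J_def)
    show "0 < hash_dist 3 n C" by fact
    fix x :: "nat \<Rightarrow> 3" and a :: 3
    assume x: "x \<in> N \<rightarrow>\<^sub>E UNIV" and nz: "a \<noteq> 0 \<or> (\<exists>i\<in>N. x i \<noteq> 0)"
    define y where "y = (\<lambda>i\<in>{..<m}. if i = i0 then 0 else if i = i1 then a else x i)"
    define e where "e = lin_comb n m b y"
    have y: "y \<in> {..<m} \<rightarrow>\<^sub>E UNIV" by (simp add: y_def)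
    then have eC: "e \<in> C" using img by (simp add: e_def)
    have e_nth: "e ! j = a * b i1 ! j + (\<Sum>i\<in>N. x i * b i ! j)" if "j < n" for j
    proof -
      have "e ! j = (\<Sum>i\<in>{..<m}. y i * b i ! j)"
        using that by (simp add: e_def lin_comb_nth)
      also have "{..<m} = insert i0 (insert i1 N)"
        using i0 i1 by (auto simp: N_def)
      also have "(\<Sum>i\<in>insert i0 (insert i1 N). y i * b i ! j) = a * b i1 ! j + (\<Sum>i\<in>N. y i * b i ! j)"
        using i0 i1 by (simp add: N_def y_def)
      also have "(\<Sum>i\<in>N. y i * b i ! j) = (\<Sum>i\<in>N. x i * b i ! j)"
        by (intro sum.cong) (auto simp: N_def y_def)
      finally show ?thesis .
    qed
    \<comment> \<open>The coefficient at \<open>i0\<close> separates \<open>e\<close> from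
      \<open>t\<close>, where it is nonzero.\<close>
    have "y i0 = 0" using i0 by (simp add: y_def)
    then have "e \<noteq> t"
      using inj y a0 i0(2) unfolding e_def inj_on_def by metis
    have z: "replicate n 0 = lin_comb n m b (\<lambda>i\<in>{..<m}. 0)"
      by (rule lin_comb_zero[symmetric]) simp
    have "\<exists>i<m. y i \<noteq> 0"
      using nz i1 by (auto simp: y_def N_def)
    then have "y \<noteq> (\<lambda>i\<in>{..<m}. 0)" by auto
    then have "e \<noteq> replicate n 0"
      using inj y unfolding z e_def inj_on_def by (metis restrict_PiE UNIV_I restrict_PiE_iff)
    have "replicate n 0 \<in> C" using C by (simp add: linear_code_def)
    then have "hash_dist 3 n C \<le> joint_hash n [replicate n 0, t, e]"
      using t eC \<open>e \<noteq> t\<close> \<open>e \<noteq> replicate n 0\<close> by (intro hash_dist_le) auto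
    also have "\<dots> \<le> card {j\<in>J. t ! j + a * b i1 ! j + (\<Sum>i\<in>N. x i * b i ! j) = 0}"
      unfolding joint_hash_def
    proof (intro card_mono subsetI)
      show "finite {j\<in>J. t ! j + a * b i1 ! j + (\<Sum>i\<in>N. x i * b i ! j) = 0}"
        by (simp add: J_def)
      fix j assume "j \<in> {i. i < n \<and> distinct (map (\<lambda>c. c ! i) [replicate n 0, t, e])}"
      then have j: "j < n" "t ! j \<noteq> 0" "e ! j \<noteq> 0" "t ! j \<noteq> e ! j" by auto
      \<comment> \<open>Two distinct nonzero elements of the field are 1 and 2, which are negatives
        of each other.\<close>
      then have "t ! j + e ! j = 0"
        using F3_cases[of "t ! j"] F3_cases[of "e ! j"] by auto
      then show "j \<in> {j\<in>J. t ! j + a * b i1 ! j + (\<Sum>i\<in>N. x i * b i ! j) = 0}"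
        using j by (simp add: J_def e_nth add.assoc)
    qed
    finally show "hash_dist 3 n C \<le> card {j\<in>J. t ! j + a * b i1 ! j + (\<Sum>i\<in>N. x i * b i ! j) = 0}" .
  qed
  then show ?thesis by (simp add: cardN J_def)
qed

lemma card_code:
  assumes "code_dim n C m"
  shows "card C = 3 ^ m"
proof -
  obtain b where "bij_betw (lin_comb n m b) ({..<m} \<rightarrow>\<^sub>E UNIV) C"
    using assms by (auto simp: code_dim_def)
  then have "card C = card ({..<m} \<rightarrow>\<^sub>E (UNIV :: 3 set))"
    by (simp add: bij_betw_same_card)
  then show ?thesis by (simp add: card_PiE)
qed

subsection \<open>The first linear programming bound\<close>

text \<open>The nontrivial additive character of the field, sending 1 to a primitive cube root of
  unity.\<close>

definition psi :: "3 \<Rightarrow> complex" where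
  "psi x = (if x = 0 then 1 else if x = 1 then Complex (-1/2) (sqrt 3 / 2) else Complex (-1/2) (- sqrt 3 / 2))"

lemma psi_0 [simp]: "psi 0 = 1"
  by (simp add: psi_def)

lemma psi_add: "psi (x + y) = psi x * psi y"
  using F3_cases[of x] F3_cases[of y]
  by (elim disjE) (simp_all add: psi_def complex_eq_iff)

lemma psi_minus: "psi (- x) = cnj (psi x)"
  using F3_cases[of x] by (elim disjE) (simp_all add: psi_def complex_eq_iff)

lemma psi_eq_1_iff: "psi x = 1 \<longleftrightarrow> x = 0"
  using F3_cases[of x] by (elim disjE) (simp_all add: psi_def complex_eq_iff)

lemma psi_add_double: "psi x + psi (2 * x) = (if x = 0 then 2 else -1)"
  using F3_cases[of x] by (elim disjE) (simp_all add: psi_def complex_eq_iff)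

text \<open>Extensional functions instead of lists, so that a coordinate is changed by function
  update and sums over words factor over coordinates.\<close>

definition words :: "nat \<Rightarrow> (nat \<Rightarrow> 3) set" where
  "words n = {..<n} \<rightarrow>\<^sub>E UNIV"

definition weight :: "nat \<Rightarrow> (nat \<Rightarrow> 3) \<Rightarrow> nat" where
  "weight n y = card {j. j < n \<and> y j \<noteq> 0}"

definition pairing :: "nat \<Rightarrow> 3 list \<Rightarrow> (nat \<Rightarrow> 3) \<Rightarrow> 3" where
  "pairing n c y = (\<Sum>j<n. c ! j * y j)"

text \<open>The adjacency operator of the Hamming graph on ternary words: adding 1 or 2 runs through
  the two other values of a coordinate.\<close>

definition neighbor_sum :: "nat \<Rightarrow> ((nat \<Rightarrow> 3) \<Rightarrow> real) \<Rightarrow> (nat \<Rightarrow> 3) \<Rightarrow> real" where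
  "neighbor_sum n f y = (\<Sum>j<n. \<Sum>a\<in>{1, 2}. f (y(j := y j + a)))"

lemma finite_words: "finite (words n)"
  unfolding words_def by (intro finite_PiE) auto

lemma upd_in_words: "y \<in> words n \<Longrightarrow> j < n \<Longrightarrow> y(j := a) \<in> words n"
  by (auto simp: words_def PiE_iff extensional_def)

lemma finite_linear_code:
  assumes "linear_code n C"
  shows "finite C"
proof (rule finite_subset)
  show "C \<subseteq> {v. set v \<subseteq> UNIV \<and> length v = n}"
    using assms by (auto simp: linear_code_def)
qed (rule finite_lists_length_eq, simp)

text \<open>If \<open>u\<close> is orthogonal to the code, every term is 1. Otherwise translation by
  a codeword not orthogonal to \<open>u\<close> permutes the code and multiplies the sum by a number
  other than 1, so the sum is 0.\<close>

lemma char_sum_code: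
  assumes C: "linear_code n C"
  shows "\<exists>r\<ge>0. (\<Sum>c\<in>C. psi (pairing n c u)) = of_real r"
proof (cases "\<forall>c\<in>C. pairing n c u = 0")
  case True
  then show ?thesis by (intro exI[of _ "real (card C)"]) simp
next
  case False
  then obtain c0 where c0: "c0 \<in> C" "pairing n c0 u \<noteq> 0" by blast
  have len: "length c = n" if "c \<in> C" for c
    using C that by (auto simp: linear_code_def)
  have fin: "finite C" using C by (rule finite_linear_code)
  have inj: "inj_on (map2 (+) c0) C"
  proof (rule inj_onI)
    fix c c' assume *: "c \<in> C" "c' \<in> C" "map2 (+) c0 c = map2 (+) c0 c'"
    show "c = c'"
    proof (rule nth_equalityI)
      fix i assume "i < length c"
      then have i: "i < length c0" "i < length c" "i < length c'"
        using * len c0 by simp_all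
      then have "c0 ! i + c ! i = map2 (+) c0 c ! i" by simp
      also have "\<dots> = map2 (+) c0 c' ! i" by (simp only: *(3))
      also have "\<dots> = c0 ! i + c' ! i" using i by simp
      finally show "c ! i = c' ! i" by simp
    qed (use * len in simp)
  qed
  have "map2 (+) c0 ` C = C"
    using C c0 by (intro endo_inj_surj fin inj) (auto simp: linear_code_def)
  then have "(\<Sum>c\<in>C. psi (pairing n c u)) = (\<Sum>c\<in>C. psi (pairing n (map2 (+) c0 c) u))"
    using sum.reindex[OF inj, of "\<lambda>c. psi (pairing n c u)"] by simp
  also have "\<dots> = (\<Sum>c\<in>C. psi (pairing n c0 u) * psi (pairing n c u))"
  proof (rule sum.cong[OF refl])
    fix c assume "c \<in> C"
    then have "pairing n (map2 (+) c0 c) u = pairing n c0 u + pairing n c u"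
      using len c0 by (simp add: pairing_def distrib_right sum.distrib)
    then show "psi (pairing n (map2 (+) c0 c) u) = psi (pairing n c0 u) * psi (pairing n c u)"
      by (simp add: psi_add)
  qed
  also have "\<dots> = psi (pairing n c0 u) * (\<Sum>c\<in>C. psi (pairing n c u))"
    by (simp only: sum_distrib_left)
  finally have "(1 - psi (pairing n c0 u)) * (\<Sum>c\<in>C. psi (pairing n c u)) = 0"
    by (simp only: left_diff_distrib) simp
  then have "(\<Sum>c\<in>C. psi (pairing n c u)) = 0"
    using c0(2) psi_eq_1_iff[of "pairing n c0 u"] by simp
  then show ?thesis by (intro exI[of _ 0]) simp
qed

lemma pairing_upd: "j < n \<Longrightarrow> pairing n c (y(j := y j + a)) = pairing n c y + c ! j * a"
proof -
  assume j: "j < n"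
  have "pairing n c (y(j := y j + a)) = c ! j * (y j + a) + (\<Sum>i\<in>{..<n} - {j}. c ! i * y i)"
    unfolding pairing_def using j by (subst sum.remove[of _ j]) auto
  moreover have "pairing n c y = c ! j * y j + (\<Sum>i\<in>{..<n} - {j}. c ! i * y i)"
    unfolding pairing_def using j by (subst sum.remove[of _ j]) auto
  ultimately show ?thesis by (simp add: distrib_left)
qed

text \<open>The unnormalised Fourier transform, needed only at codewords.\<close>

definition char_transform :: "nat \<Rightarrow> ((nat \<Rightarrow> 3) \<Rightarrow> real) \<Rightarrow> 3 list \<Rightarrow> complex" where
  "char_transform n f c = (\<Sum>y\<in>words n. of_real (f y) * psi (pairing n c y))"

lemma char_transform_shift:
  assumes "j < n"
  shows "char_transform n (\<lambda>y. f (y(j := y j + a))) c = psi (- (c ! j * a)) * char_transform n f c"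
proof -
  have "char_transform n (\<lambda>y. f (y(j := y j + a))) c =
      (\<Sum>y\<in>words n. of_real (f y) * psi (pairing n c (y(j := y j + (- a)))))"
    unfolding char_transform_def using assms
    by (intro sum.reindex_bij_witness[where i = "\<lambda>y. y(j := y j + (- a))" and j = "\<lambda>y. y(j := y j + a)"])
       (auto simp: upd_in_words)
  also have "\<dots> = (\<Sum>y\<in>words n. psi (- (c ! j * a)) * (of_real (f y) * psi (pairing n c y)))"
    unfolding pairing_upd[OF assms] psi_add by (simp add: mult_ac)
  finally show ?thesis
    by (simp add: char_transform_def sum_distrib_left)
qed

text \<open>Characters diagonalise the adjacency operator: a coordinate contributes 2 where
  \<open>c\<close> is zero and -1 on its support.\<close>

lemma char_transform_neighbor_sum:
  "char_transform n (neighbor_sum n f) c =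
    of_real (2 * real n - 3 * real (weight n (\<lambda>j. c ! j))) * char_transform n f c"
proof -
  have "char_transform n (neighbor_sum n f) c =
      (\<Sum>y\<in>words n. \<Sum>j<n. \<Sum>a\<in>{1, 2}. of_real (f (y(j := y j + a))) * psi (pairing n c y))"
    unfolding char_transform_def neighbor_sum_def of_real_sum sum_distrib_right ..
  also have "\<dots> = (\<Sum>j<n. \<Sum>y\<in>words n. \<Sum>a\<in>{1, 2}. of_real (f (y(j := y j + a))) * psi (pairing n c y))"
    by (rule sum.swap)
  also have "\<dots> = (\<Sum>j<n. \<Sum>a\<in>{1, 2}. \<Sum>y\<in>words n. of_real (f (y(j := y j + a))) * psi (pairing n c y))"
    by (intro sum.cong refl sum.swap)
  also have "\<dots> = (\<Sum>j<n. \<Sum>a\<in>{1, 2}. psi (- (c ! j * a)) * char_transform n f c)"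
    using char_transform_shift[where f = f and c = c] by (intro sum.cong refl) (simp add: char_transform_def)
  also have "\<dots> = (\<Sum>j<n. of_real (2 - 3 * (if c ! j \<noteq> 0 then 1 else 0)) * char_transform n f c)"
  proof (intro sum.cong refl)
    fix j
    have "(\<Sum>a\<in>{1, 2}. psi (- (c ! j * a)) * char_transform n f c) 
        = (psi (- (c ! j)) + psi (2 * (- (c ! j)))) * char_transform n f c"
      by (simp add: distrib_right mult.commute[of _ 2])
    then show "(\<Sum>a\<in>{1, 2}. psi (- (c ! j * a)) * char_transform n f c) = 
        of_real (2 - 3 * (if c ! j \<noteq> 0 then 1 else 0)) * char_transform n f c"
      unfolding psi_add_double by simp
  qed
  also have "\<dots> = of_real (\<Sum>j<n. 2 - 3 * (if c ! j \<noteq> 0 then 1 else 0)) * char_transform n f c"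
    by (simp only: of_real_sum sum_distrib_right)
  also have "(\<Sum>j<n. 2 - 3 * (if c ! j \<noteq> 0 then 1 else 0)) = 2 * real n - 3 * real (weight n (\<lambda>j. c ! j))"
  proof -
    have "(\<Sum>j<n. (if c ! j \<noteq> 0 then 1 else 0 :: real)) = real (weight n (\<lambda>j. c ! j))"
      by (simp add: weight_def sum.If_cases Int_def flip: sum.inter_filter)
    then show ?thesis by (simp add: sum_subtractf flip: sum_distrib_left)
  qed
  finally show ?thesis .
qed

text \<open>The eigenvalue gap makes the zero codeword carry at least a fraction 1 / (2n + 1) of the
  Fourier mass on the code. That mass is at least \<open>card C\<close> times the squared norm of
  \<open>f\<close>, while the part at zero is at most \<open>card B\<close> times it.\<close>

lemma card_code_le_card_support:
  assumes C: "linear_code n C"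
    and d: "\<And>c. c \<in> C \<Longrightarrow> c \<noteq> replicate n 0 \<Longrightarrow> d \<le> real (weight n (\<lambda>j. c ! j))"
    and f0: "\<And>y. 0 \<le> f y" and supp: "\<And>y. y \<in> words n - B \<Longrightarrow> f y = 0" and B: "B \<subseteq> words n"
    and pos: "y0 \<in> words n" "0 < f y0"
    and eig: "\<And>y. y \<in> words n \<Longrightarrow> lam * f y \<le> neighbor_sum n f y"
    and lam: "0 \<le> lam" "2 * real n - 3 * d + 1 \<le> lam"
  shows "real (card C) \<le> (2 * real n + 1) * real (card B)"
proof -
  define z where "z = replicate n (0::3)"
  have zC: "z \<in> C" using C by (simp add: z_def linear_code_def)
  have finC: "finite C" using C by (rule finite_linear_code)
  \<comment> \<open>The kernel of the Parseval sum over the code. Its nonnegativity lets the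
    pointwise inequality \<open>eig\<close> be summed, and its diagonal equals the size of the
    code.\<close>
  define r where "r y y' = Re (\<Sum>c\<in>C. psi (pairing n c (\<lambda>j. y j - y' j)))" for y y'
  have r: "(\<Sum>c\<in>C. psi (pairing n c (\<lambda>j. y j - y' j))) = of_real (r y y')" "0 \<le> r y y'" for y y'
    using char_sum_code[OF C, of "\<lambda>j. y j - y' j"] unfolding r_def by (metis Re_complex_of_real)+
  have rdiag: "r y y = real (card C)" for y
    by (simp add: r_def pairing_def)
  define P where "P c = (cmod (char_transform n f c))\<^sup>2" for c
  have P0: "0 \<le> P c" for c by (simp add: P_def)
  have parseval: "(\<Sum>c\<in>C. char_transform n g c * cnj (char_transform n f c)) =
      of_real (\<Sum>y\<in>words n. \<Sum>y'\<in>words n. g y * f y' * r y y')" for g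
  proof -
    have "(\<Sum>c\<in>C. char_transform n g c * cnj (char_transform n f c)) =
      (\<Sum>c\<in>C. \<Sum>y\<in>words n. \<Sum>y'\<in>words n. of_real (g y * f y') * psi (pairing n c (\<lambda>j. y j - y' j)))"
    proof (rule sum.cong[OF refl])
      fix c
      have "psi (pairing n c (\<lambda>j. y j - y' j)) = psi (pairing n c y) * cnj (psi (pairing n c y'))" for y y'
      proof -
        have "pairing n c (\<lambda>j. y j - y' j) = pairing n c y + (- pairing n c y')"
          by (simp add: pairing_def right_diff_distrib sum_subtractf)
        then show ?thesis by (simp only: psi_add psi_minus)
      qed
      then show "char_transform n g c * cnj (char_transform n f c) =
          (\<Sum>y\<in>words n. \<Sum>y'\<in>words n. of_real (g y * f y') * psi (pairing n c (\<lambda>j. y j - y' j)))"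
        by (simp add: char_transform_def sum_product mult_ac)
    qed
    also have "\<dots> = (\<Sum>y\<in>words n. \<Sum>c\<in>C. \<Sum>y'\<in>words n. of_real (g y * f y') * psi (pairing n c (\<lambda>j. y j - y' j)))"
      by (rule sum.swap)
    also have "\<dots> = (\<Sum>y\<in>words n. \<Sum>y'\<in>words n. \<Sum>c\<in>C. of_real (g y * f y') * psi (pairing n c (\<lambda>j. y j - y' j)))"
      by (intro sum.cong refl sum.swap)
    also have "\<dots> = (\<Sum>y\<in>words n. \<Sum>y'\<in>words n. of_real (g y * f y' * r y y'))"
      unfolding sum_distrib_left[symmetric] r(1) by simp
    finally show ?thesis by simp
  qed
  have "complex_of_real (\<Sum>c\<in>C. P c) = (\<Sum>c\<in>C. char_transform n f c * cnj (char_transform n f c))"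
    by (simp only: P_def complex_norm_square of_real_sum)
  then have S2: "(\<Sum>c\<in>C. P c) = (\<Sum>y\<in>words n. \<Sum>y'\<in>words n. f y * f y' * r y y')"
    unfolding parseval of_real_eq_iff .
  define K where "K c = 2 * real n - 3 * real (weight n (\<lambda>j. c ! j))" for c
  have "complex_of_real (\<Sum>c\<in>C. K c * P c) = (\<Sum>c\<in>C. char_transform n (neighbor_sum n f) c * cnj (char_transform n f c))"
    unfolding char_transform_neighbor_sum K_def[symmetric]
    by (simp only: P_def complex_norm_square of_real_sum of_real_mult mult.assoc)
  then have S1: "(\<Sum>c\<in>C. K c * P c) = (\<Sum>y\<in>words n. \<Sum>y'\<in>words n. neighbor_sum n f y * f y' * r y y')"
    unfolding parseval of_real_eq_iff .
  have "lam * (\<Sum>c\<in>C. P c) = (\<Sum>y\<in>words n. \<Sum>y'\<in>words n. lam * f y * f y' * r y y')"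
    unfolding S2 by (simp add: sum_distrib_left mult.assoc)
  also have "\<dots> \<le> (\<Sum>y\<in>words n. \<Sum>y'\<in>words n. neighbor_sum n f y * f y' * r y y')"
    by (intro sum_mono mult_right_mono eig f0 r)
  finally have lower: "lam * (\<Sum>c\<in>C. P c) \<le> (\<Sum>c\<in>C. K c * P c)"
    unfolding S1 .
  have Psplit: "(\<Sum>c\<in>C. P c) = P z + (\<Sum>c\<in>C - {z}. P c)"
    using finC zC by (rule sum.remove)
  have "(\<Sum>c\<in>C. K c * P c) = K z * P z + (\<Sum>c\<in>C - {z}. K c * P c)"
    using finC zC by (rule sum.remove)
  \<comment> \<open>The zero codeword has eigenvalue \<open>2 * n\<close>, all others at most
    \<open>lam - 1\<close>. After cancelling \<open>lam\<close> times the total mass against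
    \<open>lower\<close>, one copy of that mass remains.\<close>
  also have "\<dots> \<le> 2 * real n * P z + (\<Sum>c\<in>C - {z}. (lam - 1) * P c)"
  proof (intro add_mono sum_mono mult_right_mono P0)
    show "K z \<le> 2 * real n" by (simp add: K_def)
    fix c assume "c \<in> C - {z}"
    then show "K c \<le> lam - 1"
      using d[of c] lam(2) by (simp add: K_def z_def)
  qed
  also have "\<dots> = 2 * real n * P z + (lam - 1) * ((\<Sum>c\<in>C. P c) - P z)"
    unfolding Psplit by (simp add: sum_distrib_left)
  finally have "(\<Sum>c\<in>C. P c) \<le> (2 * real n + 1 - lam) * P z"
    using lower by (simp add: algebra_simps)
  also have "\<dots> \<le> (2 * real n + 1) * P z"
    using lam(1) by (intro mult_right_mono P0) simp
  finally have upper: "(\<Sum>c\<in>C. P c) \<le> (2 * real n + 1) * P z" .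
  define q where "q = (\<Sum>y\<in>words n. (f y)\<^sup>2)"
  have q: "0 < q"
    unfolding q_def using pos finite_words by (intro sum_pos2[of _ y0]) auto
  have "real (card C) * q = (\<Sum>y\<in>words n. f y * f y * r y y)"
    by (simp add: q_def rdiag sum_distrib_left power2_eq_square mult_ac)
  \<comment> \<open>All off-diagonal terms are nonnegative and are dropped from the other
    side.\<close>
  also have "\<dots> \<le> (\<Sum>y\<in>words n. \<Sum>y'\<in>words n. f y * f y' * r y y')"
  proof (rule sum_mono)
    fix y assume "y \<in> words n"
    then show "f y * f y * r y y \<le> (\<Sum>y'\<in>words n. f y * f y' * r y y')"
      using f0 r(2) finite_words
      by (intro member_le_sum[where f = "\<lambda>y'. f y * f y' * r y y'"]) auto
  qed
  also have "\<dots> \<le> (2 * real n + 1) * P z" using upper unfolding S2 .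
  also have "P z = (\<Sum>y\<in>words n. f y)\<^sup>2"
  proof -
    have "pairing n z y = 0" for y by (simp add: pairing_def z_def)
    then have "char_transform n f z = of_real (\<Sum>y\<in>words n. f y)"
      by (simp add: char_transform_def)
    then show ?thesis by (simp only: P_def norm_of_real power2_abs)
  qed
  also have "(\<Sum>y\<in>words n. f y) = (\<Sum>y\<in>B. f y)"
    using B supp finite_words by (intro sum.mono_neutral_right) auto
  also have "(2 * real n + 1) * (\<Sum>y\<in>B. f y)\<^sup>2 \<le> (2 * real n + 1) * (real (card B) * q)"
  proof (rule mult_left_mono)
    \<comment> \<open>Cauchy-Schwarz on the support.\<close>
    have "(\<Sum>y\<in>B. f y)\<^sup>2 \<le> (\<Sum>y\<in>B. (f y)\<^sup>2) * real (card B)"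
      by (rule sum_squared_le_sum_of_squares)
    also have "\<dots> \<le> q * real (card B)"
      unfolding q_def using B finite_words by (intro mult_right_mono sum_mono2) auto
    finally show "(\<Sum>y\<in>B. f y)\<^sup>2 \<le> real (card B) * q" by (simp add: mult.commute)
  qed simp
  finally have "real (card C) * q \<le> ((2 * real n + 1) * real (card B)) * q"
    by (simp add: mult.assoc)
  then show ?thesis using q by simp
qed

section \<open>Radial test functions on the Hamming graph\<close>

lemma weight_upd:
  assumes "j < n"
  shows "weight n (y(j := b)) = card {k. k < n \<and> k \<noteq> j \<and> y k \<noteq> 0} + (if b = 0 then 0 else 1)"
proof -
  have "{k. k < n \<and> (y(j := b)) k \<noteq> 0} =
      (if b = 0 then {} else {j}) \<union> {k. k < n \<and> k \<noteq> j \<and> y k \<noteq> 0}"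
    using assms by auto
  then show ?thesis
    by (auto simp: weight_def card_insert_if)
qed

text \<open>On the support of \<open>y\<close> one of the two changes lowers the weight and the
  other keeps it; off the support both raise it. For \<open>i = 0\<close> the truncated
  \<open>i - 1\<close> is harmless, as its coefficient is 0.\<close>

lemma neighbor_sum_radial:
  fixes g :: "nat \<Rightarrow> real"
  assumes i: "i = weight n y"
  shows "neighbor_sum n (\<lambda>y. g (weight n y)) y =
    real i * (g (i - 1) + g i) + 2 * (real n - real i) * g (i + 1)"
proof -
  have step: "(\<Sum>a\<in>{1, 2}. g (weight n (y(j := y j + a)))) =
      (if y j \<noteq> 0 then g (i - 1) + g i else 2 * g (i + 1))" if j: "j < n" for j
  proof -
    define w where "w = card {k. k < n \<and> k \<noteq> j \<and> y k \<noteq> 0}"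
    have "i = w + (if y j = 0 then 0 else 1)"
      using weight_upd[OF j, of y "y j"] by (simp add: w_def i)
    then show ?thesis
      using F3_cases[of "y j"]
      by (elim disjE) (simp_all add: weight_upd[OF j] flip: w_def)
  qed
  have card: "card {j. j < n \<and> y j = 0} = n - i"
  proof -
    have "{j. j < n \<and> y j = 0} = {..<n} - {j. j < n \<and> y j \<noteq> 0}" by auto
    then show ?thesis
      by (simp add: i weight_def card_Diff_subset subset_eq)
  qed
  have "i \<le> n"
    unfolding i weight_def by (rule order_trans[OF card_mono[of "{..<n}"]]) auto
  have "neighbor_sum n (\<lambda>y. g (weight n y)) y = (\<Sum>j<n. if y j \<noteq> 0 then g (i - 1) + g i else 2 * g (i + 1))"
    unfolding neighbor_sum_def using step by (intro sum.cong) auto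
  also have "\<dots> = real (card {j. j < n \<and> y j \<noteq> 0}) * (g (i - 1) + g i) + real (card {j. j < n \<and> y j = 0}) * (2 * g (i + 1))"
    by (simp add: sum.If_cases Int_def lessThan_def)
  finally show ?thesis
    using \<open>i \<le> n\<close> by (simp add: card i[unfolded weight_def, symmetric] of_nat_diff)
qed

lemma exists_word_of_weight:
  assumes "k \<le> n"
  shows "\<exists>y\<in>words n. weight n y = k"
proof -
  define y :: "nat \<Rightarrow> 3" where "y = (\<lambda>j\<in>{..<n}. if j < k then 1 else 0)"
  have "{j. j < n \<and> y j \<noteq> 0} = {..<k}" using assms by (auto simp: y_def)
  then have "weight n y = k" by (simp add: weight_def)
  then show ?thesis by (intro bexI[of _ y]) (auto simp: words_def y_def)
qed

text \<open>The test function is an approximate eigenfunction of the tridiagonal operator with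
  coefficients frozen at \<open>p\<close> and \<open>2 * (n - r)\<close> on the weights from \<open>p\<close> to \<open>r\<close>: a geometric factor
  \<open>\<mu> ^ i\<close> symmetrises that operator, and the parabola \<open>s\<close> replaces the sine of the exact
  eigenfunction.\<close>

lemma card_code_le_card_ball:
  assumes C: "linear_code n C"
    and d: "\<And>c. c \<in> C \<Longrightarrow> c \<noteq> replicate n 0 \<Longrightarrow> d \<le> real (weight n (\<lambda>j. c ! j))"
    and p: "0 < p" "p + 2 \<le> r" "r < n"
    and lam: "2 * real n - 3 * d + 1 \<le>
      real p + sqrt (real p * (2 * (real n - real r))) * (2 - 2 / (real r - real p - 1))"
  shows "real (card C) \<le> (2 * real n + 1) * real (card {y \<in> words n. weight n y \<le> r})"
proof -
  define \<alpha> \<beta> where "\<alpha> = real p" and "\<beta> = 2 * (real n - real r)"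
  \<comment> \<open>The ratio \<open>\<mu>\<close> is chosen so that the downward coefficient
    \<open>\<alpha>\<close> and the upward coefficient \<open>\<beta>\<close> both turn into
    \<open>h\<close> once \<open>\<mu> ^ i\<close> is factored out.\<close>
  define h \<mu> where "h = sqrt (\<alpha> * \<beta>)" and "\<mu> = sqrt (\<alpha> / \<beta>)"
  define K where "K = real r - real p"
  define l where "l = \<alpha> + h * (2 - 2 / (K - 1))"
  define s where "s i = (real i - real p) * (real r - real i)" for i :: nat
  define g where "g i = (if p \<le> i \<and> i \<le> r then \<mu> ^ i * s i else 0)" for i
  have \<alpha>\<beta>: "0 < \<alpha>" "0 < \<beta>" using p by (auto simp: \<alpha>_def \<beta>_def)
  then have h: "0 < h" and \<mu>: "0 < \<mu>" by (auto simp: h_def \<mu>_def)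
  have K: "1 \<le> K - 1" using p by (simp add: K_def)
  have \<mu>h: "h * \<mu> = \<alpha>"
    using \<alpha>\<beta> by (simp add: h_def \<mu>_def real_sqrt_divide real_sqrt_mult)
  have "\<beta> * \<mu> = (\<beta> / sqrt \<beta>) * sqrt \<alpha>"
    by (simp add: \<mu>_def real_sqrt_divide)
  then have \<mu>h': "\<beta> * \<mu> = h"
    using \<alpha>\<beta> by (simp add: real_div_sqrt h_def real_sqrt_mult mult.commute)
  have g0: "0 \<le> g i" for i
    using \<mu> by (auto simp: g_def s_def)
  have "2 / (K - 1) \<le> 2" using K by (simp add: field_simps)
  then have l0: "0 \<le> l" using \<alpha>\<beta> h by (simp add: l_def)
  have eig: "l * g i \<le> real i * (g (i - 1) + g i) + 2 * (real n - real i) * g (i + 1)" if "i \<le> n" for i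
  proof (cases "p < i \<and> i < r")
    \<comment> \<open>At the ends and outside the interval the left side is 0 and the right side is
      nonnegative.\<close>
    case False
    then have "g i = 0" by (auto simp: g_def s_def)
    then show ?thesis using g0 that by simp
  next
    case True
    then obtain k where k: "i = Suc k" "p \<le> k" "k \<le> r" by (cases i) auto
    have g: "g (i - 1) = \<mu> ^ k * s k" "g i = \<mu> ^ i * s i" "g (i + 1) = \<mu> ^ (i + 1) * s (i + 1)"
      using True k by (auto simp: g_def)
    have \<mu>1: "\<alpha> * \<mu> ^ k = h * \<mu> ^ i" and \<mu>2: "\<beta> * \<mu> ^ (i + 1) = h * \<mu> ^ i"
      using \<mu>h \<mu>h' by (auto simp: k(1) mult.assoc[symmetric])
    \<comment> \<open>The parabola has constant second difference -2.\<close>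
    have ss: "s k + s (i + 1) = 2 * s i - 2"
      by (simp add: s_def k(1) algebra_simps)
    \<comment> \<open>At interior integers the parabola is at least \<open>K - 1\<close>, so the
      loss of 2 is at most the fraction \<open>2 / (K - 1)\<close> of \<open>s i\<close>.\<close>
    have "0 \<le> (real i - real p - 1) * (real r - real i - 1)"
      using True by (intro mult_nonneg_nonneg) auto
    then have "K - 1 \<le> s i"
      by (simp add: s_def K_def algebra_simps)
    then have "2 \<le> 2 * s i / (K - 1)" using K by (simp add: le_divide_eq)
    then have "(2 - 2 / (K - 1)) * s i \<le> 2 * s i - 2"
      using K by (simp add: left_diff_distrib)
    then have "h * \<mu> ^ i * ((2 - 2 / (K - 1)) * s i) \<le> h * \<mu> ^ i * (s k + s (i + 1))"
      unfolding ss using h \<mu> by (intro mult_left_mono) auto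
    also have "\<dots> = \<alpha> * \<mu> ^ k * s k + \<beta> * \<mu> ^ (i + 1) * s (i + 1)"
      unfolding \<mu>1 \<mu>2 by (simp add: distrib_left)
    finally have "l * g i \<le> \<alpha> * g (i - 1) + \<alpha> * g i + \<beta> * g (i + 1)"
      unfolding g l_def by (simp add: algebra_simps)
    \<comment> \<open>Unfreezing the coefficients only helps: \<open>p < i\<close> and
      \<open>i < r\<close>, and \<open>g\<close> is nonnegative.\<close>
    also have "\<dots> \<le> real i * g (i - 1) + real i * g i + 2 * (real n - real i) * g (i + 1)"
      using True by (intro add_mono mult_right_mono g0) (auto simp: \<alpha>_def \<beta>_def)
    finally show ?thesis by (simp add: distrib_left)
  qed
  obtain y0 where y0: "y0 \<in> words n" "weight n y0 = p + 1"
    using exists_word_of_weight[of "p + 1" n] p by auto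
  show ?thesis
  proof (rule card_code_le_card_support[OF C d, where f = "\<lambda>y. g (weight n y)"])
    show "0 \<le> g (weight n y)" for y by (rule g0)
    show "g (weight n y) = 0" if "y \<in> words n - {y \<in> words n. weight n y \<le> r}" for y
      using that by (auto simp: g_def)
    show "y0 \<in> words n" by fact
    show "0 < g (weight n y0)" using p \<mu> by (simp add: y0 g_def s_def)
    show "0 \<le> l" by fact
    show "2 * real n - 3 * d + 1 \<le> l"
      using lam by (simp add: l_def h_def \<alpha>_def \<beta>_def K_def)
    fix y
    have "weight n y \<le> n"
      unfolding weight_def by (rule order_trans[OF card_mono[of "{..<n}"]]) auto
    then show "l * g (weight n y) \<le> neighbor_sum n (\<lambda>y. g (weight n y)) y"
      unfolding neighbor_sum_radial[OF refl] by (rule eig)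
  qed auto
qed

section \<open>Entropy bound for Hamming balls\<close>

lemma Hq_3_mult_ln:
  "0 < \<rho> \<Longrightarrow> ln 3 * Hq 3 \<rho> = - (\<rho> * ln (\<rho> / 2) + (1 - \<rho>) * ln (1 - \<rho>))"
  by (simp add: Hq_def log_def ln_div field_simps)

text \<open>Under independent coordinates with probability \<open>1 - \<rho>\<close> for 0 and
  \<open>\<rho> / 2\<close> for each nonzero symbol, every word of the ball has probability at least
  \<open>e\<close>, and the total is 1.\<close>

lemma card_ball_le:
  assumes \<rho>: "0 < \<rho>" "\<rho> < 2 / 3" and r: "real r \<le> \<rho> * real n"
  shows "real (card {y \<in> words n. weight n y \<le> r}) \<le> 3 powr (real n * Hq 3 \<rho>)"
proof -
  define q where "q a = (if a = 0 then 1 - \<rho> else \<rho> / 2)" for a :: 3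
  have q0: "0 < q a" for a using \<rho> by (simp add: q_def)
  (* the probability of a word of weight \<rho> n under the product measure with weights q *)
  define e where "e = exp (- (ln 3 * (real n * Hq 3 \<rho>)))"
  have lower: "e \<le> (\<Prod>j<n. q (y j))" if y: "weight n y \<le> r" for y
  proof -
    define w where "w = weight n y"
    have w: "real w \<le> \<rho> * real n" using y r by (simp add: w_def)
    have card: "card {j. j < n \<and> y j = 0} = n - w" "w \<le> n"
    proof -
      have "{j. j < n \<and> y j = 0} = {..<n} - {j. j < n \<and> y j \<noteq> 0}" by auto
      then show "card {j. j < n \<and> y j = 0} = n - w"
        by (simp add: w_def weight_def card_Diff_subset subset_eq)
      show "w \<le> n"
        unfolding w_def weight_def by (rule order_trans[OF card_mono[of "{..<n}"]]) auto
    qed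
    have "ln (\<Prod>j<n. q (y j)) = (\<Sum>j<n. ln (q (y j)))"
      using q0 by (intro ln_prod) (metis less_irrefl finite_lessThan)+
    also have "\<dots> = (\<Sum>j<n. if y j = 0 then ln (1 - \<rho>) else ln (\<rho> / 2))"
      by (intro sum.cong) (auto simp: q_def)
    also have "\<dots> = real (n - w) * ln (1 - \<rho>) + real w * ln (\<rho> / 2)"
      using card by (simp add: sum.If_cases Int_def lessThan_def w_def weight_def)
    finally have lnp: "ln (\<Prod>j<n. q (y j)) = (real n - real w) * ln (1 - \<rho>) + real w * ln (\<rho> / 2)"
      using card by simp
    \<comment> \<open>From \<open>\<rho> < 2 / 3\<close> it follows that
      \<open>\<rho> / 2 < 1 - \<rho>\<close>, so lighter words are more probable.\<close>
    have "0 \<le> (\<rho> * real n - real w) * (ln (1 - \<rho>) - ln (\<rho> / 2))"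
      using w \<rho> by (intro mult_nonneg_nonneg) auto
    then have "- (ln 3 * (real n * Hq 3 \<rho>)) \<le> ln (\<Prod>j<n. q (y j))"
      unfolding lnp mult.left_commute[of "ln 3"] Hq_3_mult_ln[OF \<rho>(1)] by (simp add: algebra_simps)
    then show ?thesis
      using q0 by (simp add: e_def ln_ge_iff prod_pos)
  qed
  have "(\<Prod>j<n. \<Sum>a\<in>UNIV. q a) = (\<Sum>y\<in>words n. \<Prod>j<n. q (y j))"
    unfolding words_def by (rule prod_sum_PiE) auto
  moreover have "(\<Sum>a\<in>UNIV. q a) = 1"
    unfolding UNIV_F3 by (simp add: q_def)
  ultimately have total: "(\<Sum>y\<in>words n. \<Prod>j<n. q (y j)) = 1" by simp
  have "real (card {y \<in> words n. weight n y \<le> r}) * e = (\<Sum>y\<in>{y \<in> words n. weight n y \<le> r}. e)"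
    by simp
  also have "\<dots> \<le> (\<Sum>y\<in>{y \<in> words n. weight n y \<le> r}. \<Prod>j<n. q (y j))"
    using lower by (intro sum_mono) auto
  also have "\<dots> \<le> (\<Sum>y\<in>words n. \<Prod>j<n. q (y j))"
    using q0 by (intro sum_mono2 finite_words prod_nonneg) (auto simp: less_imp_le)
  finally have "real (card {y \<in> words n. weight n y \<le> r}) * e \<le> 1" unfolding total .
  moreover have "3 powr (real n * Hq 3 \<rho>) * e = 1"
    by (simp add: e_def powr_def mult.commute flip: exp_add)
  moreover have "0 < e" by (simp add: e_def)
  ultimately show ?thesis
    using mult_le_cancel_right_pos by metis
qed

subsection \<open>Asymptotics\<close>

text \<open>The argument of \<^const>\<open>Hq\<close> in \<^const>\<open>R_LP1\<close> as a function of \<open>\<delta>\<close> is an involution: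
  \<open>3 * \<rho>0 = (sqrt (2 * (1 - \<delta>)) - sqrt \<delta>)\<^sup>2\<close>, and symmetrically in \<open>\<rho>\<close>.\<close>

lemma LP1_involution:
  fixes \<delta> \<rho> :: real
  defines "\<rho>0 \<equiv> (2 - \<delta> - 2 * sqrt (2 * \<delta> * (1 - \<delta>))) / 3"
  assumes \<delta>: "0 \<le> \<delta>" "\<delta> \<le> 2 / 3"
  shows "0 \<le> \<rho>0" and "\<rho>0 < \<rho> \<Longrightarrow> \<rho> < 2 / 3 \<Longrightarrow> 2 - 3 * \<delta> < \<rho> + 2 * sqrt (2 * \<rho> * (1 - \<rho>))"
proof -
  define a b where "a = sqrt \<delta>" and "b = sqrt (2 * (1 - \<delta>))"
  have ab: "0 \<le> a" "0 \<le> b" "a \<le> b" "a\<^sup>2 = \<delta>" "b\<^sup>2 = 2 * (1 - \<delta>)" "sqrt (2 * \<delta> * (1 - \<delta>)) = a * b"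
  proof -
    have "2 * \<delta> * (1 - \<delta>) = \<delta> * (2 * (1 - \<delta>))" by simp
    then show "sqrt (2 * \<delta> * (1 - \<delta>)) = a * b"
      unfolding a_def b_def by (simp only: real_sqrt_mult)
  qed (use \<delta> in \<open>auto simp: a_def b_def\<close>)
  have \<rho>0: "3 * \<rho>0 = (b - a)\<^sup>2"
    using ab by (simp add: \<rho>0_def power2_diff)
  then show nonneg: "0 \<le> \<rho>0" using zero_le_power2[of "b - a"] by linarith
  assume \<rho>: "\<rho>0 < \<rho>" "\<rho> < 2 / 3"
  define c d e where "c = sqrt \<rho>" and "d = sqrt (2 * (1 - \<rho>))" and "e = sqrt (3::real)"
  have cd: "0 \<le> c" "0 \<le> d" "c \<le> d" "c\<^sup>2 = \<rho>" "d\<^sup>2 = 2 * (1 - \<rho>)" "sqrt (2 * \<rho> * (1 - \<rho>)) = c * d"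
  proof -
    have "2 * \<rho> * (1 - \<rho>) = \<rho> * (2 * (1 - \<rho>))" by simp
    then show "sqrt (2 * \<rho> * (1 - \<rho>)) = c * d"
      unfolding c_def d_def by (simp only: real_sqrt_mult)
  qed (use \<rho> nonneg in \<open>auto simp: c_def d_def\<close>)
  have e: "0 \<le> e" "e\<^sup>2 = 3" by (auto simp: e_def)
  have "(b - a)\<^sup>2 < (e * c)\<^sup>2"
    using \<rho> \<rho>0 by (simp add: power_mult_distrib e cd)
  then have "b - a < e * c"
    by (rule power2_less_imp_less) (simp add: e(1) cd(1))
  then have "b < e * c + a" by simp
  then have "b\<^sup>2 < (e * c + a)\<^sup>2"
    using ab(2) by (intro power_strict_mono) simp_all
  \<comment> \<open>This form is symmetric in \<open>\<delta>\<close> and \<open>\<rho>\<close>,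
    since \<open>e * c * a\<close> is the root of \<open>3 * \<rho> * \<delta>\<close>. Undoing the
    squares with the roles exchanged yields the goal.\<close>
  then have 1: "2 < 3 * \<rho> + 3 * \<delta> + 2 * (e * c * a)"
    by (simp add: power2_sum power_mult_distrib ab cd e)
  show "2 - 3 * \<delta> < \<rho> + 2 * sqrt (2 * \<rho> * (1 - \<rho>))"
  proof (rule ccontr)
    assume "\<not> ?thesis"
    then have "(e * a)\<^sup>2 \<le> (d - c)\<^sup>2"
      by (simp add: power2_diff power_mult_distrib ab cd e mult.commute[of c])
    then have "e * a \<le> d - c"
      by (rule power2_le_imp_le) (simp add: cd(3))
    then have "e * a + c \<le> d" by simp
    then have "(e * a + c)\<^sup>2 \<le> d\<^sup>2"
      using ab(1) cd(1) e(1) by (intro power_mono) simp_all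
    moreover have "(e * a + c)\<^sup>2 = 3 * \<delta> + \<rho> + 2 * (e * c * a)"
      by (simp add: power2_sum power_mult_distrib ab(4) cd(4) e(2))
    ultimately show False
      using 1 cd(5) by argo
  qed
qed

text \<open>A window of weights of constant width ending at about \<open>\<rho> * n\<close>
  suffices: both of its ends are asymptotic to \<open>\<rho> * n\<close>, and the factor linear in n
  disappears from the rate.\<close>

lemma rate_le_Hq:
  fixes C :: "nat \<Rightarrow> (3 list) set" and m :: "nat \<Rightarrow> nat"
  assumes lin: "\<And>n. linear_code n (C n)" and dim: "\<And>n. code_dim n (C n) (m n)"
    and lim: "(\<lambda>n. real (m n) / real n) \<longlonglongrightarrow> R"
    and dist: "eventually (\<lambda>n. \<forall>c\<in>C n. c \<noteq> replicate n 0 \<longrightarrow> \<delta> * real n \<le> real (weight n (\<lambda>j. c ! j))) sequentially"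
    and \<rho>: "0 < \<rho>" "\<rho> < 2 / 3" "2 - 3 * \<delta> < \<rho> + 2 * sqrt (2 * \<rho> * (1 - \<rho>))"
  shows "R \<le> Hq 3 \<rho>"
proof -
  have "(\<lambda>k. \<rho> + sqrt (\<rho> * (2 * (1 - \<rho>))) * (2 - 2 / real k)) \<longlonglongrightarrow> \<rho> + sqrt (\<rho> * (2 * (1 - \<rho>))) * (2 - 0)"
    by (intro tendsto_intros tendsto_divide_0[OF tendsto_const]
        filterlim_compose[OF tendsto_inverse_0_at_top] filterlim_real_sequentially
        filterlim_at_top_imp_at_infinity)
  \<comment> \<open>The strict inequality leaves room for the loss \<open>2 / k\<close> caused by a
    finite window.\<close>
  then have "eventually (\<lambda>k. 2 - 3 * \<delta> < \<rho> + sqrt (\<rho> * (2 * (1 - \<rho>))) * (2 - 2 / real k)) sequentially"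
    using \<rho>(3) by (intro order_tendstoD(1)) (auto simp: mult_ac)
  then obtain k where k: "0 < k" "2 - 3 * \<delta> < \<rho> + sqrt (\<rho> * (2 * (1 - \<rho>))) * (2 - 2 / real k)"
    using eventually_conj[OF eventually_gt_at_top[of 0]] by (metis (no_types, lifting) eventually_happens sequentially_bot)
  define r where "r n = nat \<lfloor>\<rho> * real n\<rfloor>" for n :: nat
  \<comment> \<open>With this offset the denominator \<open>r - p - 1\<close> of the ball bound is
    exactly \<open>k\<close>, as soon as the truncated difference is positive.\<close>
  define p where "p n = r n - (k + 1)" for n
  have r: "real (r n) \<le> \<rho> * real n" "\<rho> * real n - 1 \<le> real (r n)" for n
    using \<rho> by (auto simp: r_def)
  have inv: "(\<lambda>n. c / real n) \<longlonglongrightarrow> 0" for c :: real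
    by (intro tendsto_divide_0[OF tendsto_const] filterlim_real_sequentially filterlim_at_top_imp_at_infinity)
  have rlim: "(\<lambda>n. real (r n) / real n) \<longlonglongrightarrow> \<rho>"
  proof (rule tendsto_sandwich)
    show "eventually (\<lambda>n. \<rho> - 1 / real n \<le> real (r n) / real n) sequentially"
      using eventually_gt_at_top[of 0]
    proof eventually_elim
      case (elim n)
      then have "\<rho> - 1 / real n = (\<rho> * real n - 1) / real n" by (simp add: diff_divide_distrib)
      also have "\<dots> \<le> real (r n) / real n" by (intro divide_right_mono r) simp
      finally show ?case .
    qed
    show "eventually (\<lambda>n. real (r n) / real n \<le> \<rho>) sequentially"
      using eventually_gt_at_top[of 0]
      by eventually_elim (use r in \<open>simp add: field_simps\<close>)
    show "(\<lambda>n. \<rho> - 1 / real n) \<longlonglongrightarrow> \<rho>"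
      using tendsto_diff[OF tendsto_const inv] by simp
  qed simp
  have plim: "(\<lambda>n. real (p n) / real n) \<longlonglongrightarrow> \<rho>"
  proof (rule tendsto_sandwich)
    show "(\<lambda>n. real (r n) / real n - (real k + 1) / real n) \<longlonglongrightarrow> \<rho>"
      using tendsto_diff[OF rlim inv] by simp
    show "eventually (\<lambda>n. real (r n) / real n - (real k + 1) / real n \<le> real (p n) / real n) sequentially"
      unfolding diff_divide_distrib[symmetric] p_def
      by (intro always_eventually allI divide_right_mono) auto
    show "eventually (\<lambda>n. real (p n) / real n \<le> real (r n) / real n) sequentially"
      by (intro always_eventually allI divide_right_mono) (auto simp: p_def)
  qed (rule rlim)
  have "(\<lambda>n. real (p n) / real n + sqrt (real (p n) / real n * (2 * (1 - real (r n) / real n))) * (2 - 2 / real k) - 1 / real n)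
      \<longlonglongrightarrow> \<rho> + sqrt (\<rho> * (2 * (1 - \<rho>))) * (2 - 2 / real k) - 0"
    by (intro tendsto_intros plim rlim inv)
  then have "eventually (\<lambda>n. 2 - 3 * \<delta> < real (p n) / real n + sqrt (real (p n) / real n * (2 * (1 - real (r n) / real n))) * (2 - 2 / real k) - 1 / real n) sequentially"
    using k by (intro order_tendstoD(1)) auto
  moreover have "eventually (\<lambda>n. 0 < real (p n) / real n) sequentially"
    using plim \<rho>(1) by (rule order_tendstoD(1))
  ultimately have "eventually (\<lambda>n. real (m n) / real n \<le> 1 / real n + ln (real n) / real n / ln 3 + Hq 3 \<rho>) sequentially"
    using dist eventually_gt_at_top[of 0]
  proof eventually_elim
    case (elim n)
    have n: "0 < real n" using elim by simp
    have p: "0 < p n" using elim by (simp add: zero_less_divide_iff)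
    then have pr: "real (r n) - real (p n) - 1 = real k" by (simp add: p_def)
    have rn: "r n < n"
    proof -
      have "\<rho> * real n < 1 * real n" using \<rho> n by (intro mult_strict_right_mono) auto
      then show ?thesis using r(1)[of n] by linarith
    qed
    have sq: "sqrt (real (p n) / real n * (2 * (1 - real (r n) / real n))) = sqrt (real (p n) * (2 * (real n - real (r n)))) / real n"
    proof -
      have "real (p n) / real n * (2 * (1 - real (r n) / real n)) = real (p n) * (2 * (real n - real (r n))) / (real n)\<^sup>2"
        using n by (simp add: field_simps power2_eq_square)
      then show ?thesis by (simp add: real_sqrt_divide)
    qed
    have "(2 - 3 * \<delta>) * real n < (real (p n) / real n + sqrt (real (p n) * (2 * (real n - real (r n)))) / real n * (2 - 2 / real k) - 1 / real n) * real n"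
      using elim(1) n unfolding sq by (rule mult_strict_right_mono)
    also have "\<dots> = real (p n) + sqrt (real (p n) * (2 * (real n - real (r n)))) * (2 - 2 / real k) - 1"
      using n by (simp add: left_diff_distrib distrib_right)
    finally have lam: "2 * real n - 3 * (\<delta> * real n) + 1 \<le>
        real (p n) + sqrt (real (p n) * (2 * (real n - real (r n)))) * (2 - 2 / (real (r n) - real (p n) - 1))"
      unfolding pr by (simp add: left_diff_distrib)
    have "3 ^ m n = real (card (C n))"
      by (simp add: card_code[OF dim])
    also have "\<dots> \<le> (2 * real n + 1) * real (card {y \<in> words n. weight n y \<le> r n})"
    proof (rule card_code_le_card_ball[OF lin _ _ _ rn lam])
      show "p n + 2 \<le> r n" using p k(1) by (simp add: p_def)
      show "\<delta> * real n \<le> real (weight n ((!) c))" if "c \<in> C n" "c \<noteq> replicate n 0" for c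
        using elim that by auto
    qed (use p in auto)
    also have "\<dots> \<le> (3 * real n) * 3 powr (real n * Hq 3 \<rho>)"
      using n r \<rho> by (intro mult_mono card_ball_le) auto
    finally have "ln (3 ^ m n) \<le> ln ((3 * real n) * 3 powr (real n * Hq 3 \<rho>))"
      using n by (intro ln_mono) auto
    also have "\<dots> = ln 3 + ln (real n) + real n * Hq 3 \<rho> * ln 3"
      using n by (simp add: ln_mult ln_powr)
    finally have "real (m n) * ln 3 \<le> ln 3 + ln (real n) + real n * Hq 3 \<rho> * ln 3"
      by (simp add: ln_realpow)
    then show ?case using n by (simp add: field_simps)
  qed
  moreover have "(\<lambda>n. 1 / real n + ln (real n) / real n / ln 3 + Hq 3 \<rho>) \<longlonglongrightarrow> 0 + 0 / ln 3 + Hq 3 \<rho>"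
    by (intro tendsto_intros inv lim_ln_over_n) simp
  ultimately show ?thesis
    using lim by (intro tendsto_le[OF sequentially_bot]) auto
qed

section \<open>One-sided continuity and sign of the entropy function\<close>

lemma mult_ln_tendsto_0: "((\<lambda>x::real. x * ln x) \<longlongrightarrow> 0) (at_right 0)"
proof -
  have "((\<lambda>y. - (ln y / y)) \<longlongrightarrow> - 0) (at_top :: real filter)"
    by (intro tendsto_minus ln_x_over_x_tendsto_0)
  then have "((\<lambda>x. - (ln (inverse x) / inverse x)) \<longlongrightarrow> 0) (at_right (0::real))"
    by (simp add: filterlim_at_right_to_top)
  moreover have "eventually (\<lambda>x::real. - (ln (inverse x) / inverse x) = x * ln x) (at_right 0)"
    using eventually_at_right_less[of "0::real"] by eventually_elim (simp add: ln_inverse divide_inverse mult.commute)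
  ultimately show ?thesis
    by (rule Lim_transform_eventually)
qed

text \<open>The delicate point is \<open>t = 0\<close>, where the default value of
  \<open>ln 0\<close> is multiplied by 0 and so agrees with the limit of \<open>x * ln x\<close>. It
  is reached when \<open>\<delta>star = 2 / 3\<close>.\<close>

lemma Hq_tendsto_at_right:
  assumes "0 \<le> t" "t < 1"
  shows "(Hq 3 \<longlongrightarrow> Hq 3 t) (at_right t)"
proof -
  have 1: "((\<lambda>x. x * ln x) \<longlongrightarrow> t * ln t) (at_right t)"
  proof (cases "t = 0")
    case False
    then show ?thesis using assms by (intro tendsto_intros) auto
  qed (simp add: mult_ln_tendsto_0)
  have "((\<lambda>x. x * (ln 2 / ln 3) - x * ln x / ln 3 - (1 - x) * ln (1 - x) / ln 3) \<longlongrightarrow>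
      t * (ln 2 / ln 3) - t * ln t / ln 3 - (1 - t) * ln (1 - t) / ln 3) (at_right t)"
    using assms by (intro tendsto_diff[OF tendsto_diff[OF _ tendsto_divide[OF 1 tendsto_const]]] tendsto_intros) auto
  then show ?thesis by (simp add: Hq_def[abs_def] log_def)
qed

lemma Hq_nonneg:
  assumes "0 \<le> t" "t < 1"
  shows "0 \<le> Hq 3 t"
proof -
  have "t * ln t \<le> 0"
    using assms by (cases "t = 0") (auto intro: mult_nonneg_nonpos)
  moreover have "(1 - t) * ln (1 - t) \<le> 0"
    using assms by (intro mult_nonneg_nonpos) auto
  moreover have "0 \<le> t * ln 2" using assms by simp
  ultimately show ?thesis
    by (simp add: Hq_def log_def divide_nonpos_pos add_nonneg_nonneg diff_divide_distrib[symmetric])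
qed

theorem theorem2:
  fixes C :: "nat \<Rightarrow> (3 list) set" and m :: "nat \<Rightarrow> nat"
    and R \<delta>3 \<delta>star :: real
  assumes "\<delta>3 > 0"
    and "\<And>n. linear_code n (C n)"
    and "\<And>n. code_dim n (C n) (m n)"
    and "(\<lambda>n. real (m n) / real n) \<longlonglongrightarrow> R"
    and "(\<lambda>n. real (hash_dist 3 n (C n)) / real n) \<longlonglongrightarrow> \<delta>3"
    and "0 \<le> \<delta>star" and "\<delta>star \<le> 2 / 3"
    and "\<delta>star / 2 - \<delta>3 = R_LP1 3 \<delta>star"
  shows "R \<le> \<delta>star / 2 - \<delta>3"
proof (rule ccontr)
  assume "\<not> ?thesis"
  then have less: "\<delta>star < 2 * R + 2 * \<delta>3" by simp
  define \<rho>0 where "\<rho>0 = (2 - \<delta>star - 2 * sqrt (2 * \<delta>star * (1 - \<delta>star))) / 3"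
  have eq: "\<delta>star / 2 - \<delta>3 = Hq 3 \<rho>0"
    using assms(8) by (simp add: R_LP1_def \<rho>0_def)
  have \<rho>0: "0 \<le> \<rho>0"
    using LP1_involution(1)[OF assms(6,7)] by (simp add: \<rho>0_def)
  have "0 \<le> sqrt (2 * \<delta>star * (1 - \<delta>star))"
    using assms(6,7) by simp
  then have "3 * \<rho>0 \<le> 2 - \<delta>star" by (simp add: \<rho>0_def)
  then have "0 \<le> Hq 3 \<rho>0"
    using \<rho>0 assms(6) by (intro Hq_nonneg) auto
  \<comment> \<open>The equation gives \<open>R > Hq 3 \<rho>0 \<ge> 0\<close> and
    \<open>\<delta>star / 2 = Hq 3 \<rho>0 + \<delta>3 > 0\<close>. The first makes the dimension
    eventually at least 2, the second keeps \<open>\<rho>0\<close> below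
    \<open>2 / 3\<close>.\<close>
  then have R: "0 < R" and "0 < \<delta>star"
    using eq less assms(1) by linarith+
  then have \<rho>0': "\<rho>0 < 2 / 3"
    using \<open>3 * \<rho>0 \<le> 2 - \<delta>star\<close> by linarith
  have inv: "(\<lambda>n. 4 / real n) \<longlonglongrightarrow> 0"
    by (intro tendsto_divide_0[OF tendsto_const] filterlim_real_sequentially filterlim_at_top_imp_at_infinity)
  have lim: "(\<lambda>n. 2 * (real (hash_dist 3 n (C n)) / real n) + 2 * (real (m n) / real n) - 4 / real n) \<longlonglongrightarrow> 2 * \<delta>3 + 2 * R - 0"
    by (intro tendsto_intros assms(4,5) inv)
  have "eventually (\<lambda>n. \<delta>star < 2 * (real (hash_dist 3 n (C n)) / real n) + 2 * (real (m n) / real n) - 4 / real n) sequentially"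
    by (rule order_tendstoD(1)[OF lim]) (use less in simp)
  moreover have "eventually (\<lambda>n. 0 < real (hash_dist 3 n (C n)) / real n) sequentially"
    using assms(5,1) by (rule order_tendstoD(1))
  \<comment> \<open>Subtracting \<open>1 / n\<close> turns positivity into \<open>1 < m n\<close>,
    as the weight bound needs dimension 2.\<close>
  moreover have "eventually (\<lambda>n. 0 < real (m n) / real n - 1 / real n) sequentially"
  proof (rule order_tendstoD(1))
    show "(\<lambda>n. real (m n) / real n - 1 / real n) \<longlonglongrightarrow> R"
      using tendsto_diff[OF assms(4) lim_1_over_n] by simp
  qed (rule R)
  ultimately have dist: "eventually (\<lambda>n. \<forall>c\<in>C n. c \<noteq> replicate n 0 \<longrightarrow>
      \<delta>star * real n \<le> real (weight n (\<lambda>j. c ! j))) sequentially"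
    using eventually_gt_at_top[of 0]
  proof eventually_elim
    case (elim n)
    have n: "0 < real n" using elim by simp
    have m: "2 \<le> m n" using elim(3) n by (simp add: field_simps)
    have hd: "0 < hash_dist 3 n (C n)" using elim(2) n by (simp add: zero_less_divide_iff)
    show ?case
    proof (intro ballI impI)
      fix c assume "c \<in> C n" "c \<noteq> replicate n 0"
      then have "2 * hash_dist 3 n (C n) + 2 * (m n - 2) \<le> weight n (\<lambda>j. c ! j)"
        using weight_ge_hash_dist[OF assms(2,3) m hd] by (simp add: weight_def)
      then have "2 * real (hash_dist 3 n (C n)) + 2 * real (m n) - 4 \<le> real (weight n (\<lambda>j. c ! j))"
        using m by linarith
      moreover have "\<delta>star * real n < 2 * real (hash_dist 3 n (C n)) + 2 * real (m n) - 4"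
        using mult_strict_right_mono[OF elim(1) n] n by (simp add: left_diff_distrib distrib_right)
      ultimately show "\<delta>star * real n \<le> real (weight n (\<lambda>j. c ! j))" by linarith
    qed
  qed
  have "R \<le> Hq 3 \<rho>0"
  \<comment> \<open>At \<open>\<rho>0\<close> itself the spectral condition is only an equality, so
    the bound is obtained as a limit from the right.\<close>
  proof (rule tendsto_lowerbound)
    show "(Hq 3 \<longlongrightarrow> Hq 3 \<rho>0) (at_right \<rho>0)"
      using \<rho>0 \<rho>0' by (intro Hq_tendsto_at_right) auto
    have "R \<le> Hq 3 \<rho>" if "\<rho>0 < \<rho>" "\<rho> < 2 / 3" for \<rho>
      using that \<rho>0 LP1_involution(2)[OF assms(6,7), of \<rho>]
      by (intro rate_le_Hq[OF assms(2-4) dist]) (auto simp: \<rho>0_def)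
    then show "eventually (\<lambda>\<rho>. R \<le> Hq 3 \<rho>) (at_right \<rho>0)"
      unfolding eventually_at_right[OF \<rho>0'] using \<rho>0' by blast
  qed simp
  then show False using eq less by linarith
qed

end
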